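(* Let $M$ be a monoid, and let the diagonal $M$-act be generated by a set of the form $U\times V$ where $U,V\subseteq M$. Let $A$ and $B$ be $M$-acts generated by sets $X$ and $Y$ respectively. Then the direct product $A\times B$ is generated by the set $Z=XU\times YV$, where $XU=\{xu : x\in X, u\in U\}$ and $YV=\{yv : y\in Y, v\in V\}$.
   Context: For a monoid $M$ with identity $1$, an $M$-act is a non-empty set $A$ with a map $A\times M\to A$, $(a,m)\mapsto am$, such that $a(mn)=(am)n$ and $a1=a$. A subset $U\subseteq A$ generates $A$ if every $a\in A$ equals $um$ for some $u\in U$, $m\in M$. The direct product of $M$-acts $A$ and $B$ is $A\times B$ with action $(a,b)m=(am,bm)$. The diagonal $M$-act is the set $M\times M$ with action $(a,b)c=(ac,bc)$. *)

theory Defs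
  imports "HOL-Algebra.Group"
begin

text \<open>Right acts of a monoid; the action is relevant only on the carriers.\<close>

locale monoid_act = monoid M for M (structure) +
  fixes A :: "'b set" and act :: "'b \<Rightarrow> 'a \<Rightarrow> 'b"
  assumes nonempty: "A \<noteq> {}"
    and act_closed: "\<lbrakk>a \<in> A; m \<in> carrier M\<rbrakk> \<Longrightarrow> act a m \<in> A"
    and act_mult: "\<lbrakk>a \<in> A; m \<in> carrier M; n \<in> carrier M\<rbrakk> \<Longrightarrow> act a (m \<otimes> n) = act (act a m) n"
    and act_one: "a \<in> A \<Longrightarrow> act a \<one> = a"

definition act_generated_by ::
  "('a, 'm) monoid_scheme \<Rightarrow> 'b set \<Rightarrow> ('b \<Rightarrow> 'a \<Rightarrow> 'b) \<Rightarrow> 'b set \<Rightarrow> bool"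
  where "act_generated_by M A act U \<longleftrightarrow>
    U \<subseteq> A \<and> (\<forall>a\<in>A. \<exists>u\<in>U. \<exists>m\<in>carrier M. a = act u m)"

definition prod_act ::
  "('b \<Rightarrow> 'a \<Rightarrow> 'b) \<Rightarrow> ('c \<Rightarrow> 'a \<Rightarrow> 'c) \<Rightarrow> 'b \<times> 'c \<Rightarrow> 'a \<Rightarrow> 'b \<times> 'c"
  where "prod_act actA actB = (\<lambda>(a, b) m. (actA a m, actB b m))"

definition diagonal_act :: "('a, 'm) monoid_scheme \<Rightarrow> 'a \<times> 'a \<Rightarrow> 'a \<Rightarrow> 'a \<times> 'a"
  where "diagonal_act M = (\<lambda>(a, b) c. (a \<otimes>\<^bsub>M\<^esub> c, b \<otimes>\<^bsub>M\<^esub> c))"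

definition act_image :: "('b \<Rightarrow> 'a \<Rightarrow> 'b) \<Rightarrow> 'b set \<Rightarrow> 'a set \<Rightarrow> 'b set"
  where "act_image act X U = {act x u | x u. x \<in> X \<and> u \<in> U}"

lemma monoid_act_prod:
  assumes "monoid_act M A actA" and "monoid_act M B actB"
  shows "monoid_act M (A \<times> B) (prod_act actA actB)"
proof -
  interpret A: monoid_act M A actA by fact
  interpret B: monoid_act M B actB by fact
  show ?thesis
    by unfold_locales
      (auto simp: prod_act_def A.nonempty B.nonempty A.act_closed B.act_closed
        A.act_mult B.act_mult A.act_one B.act_one)
qed

lemma monoid_act_diagonal:
  assumes "monoid M"
  shows "monoid_act M (carrier M \<times> carrier M) (diagonal_act M)"
proof -
  interpret monoid M by fact
  show ?thesis
    by unfold_locales (auto simp: diagonal_act_def m_assoc)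
qed

end

theory Submission
  imports Defs
begin

text \<open>Write a = xm and b = yn with x in X and y in Y. The multipliers m and n are unrelated,
  whereas the product act moves both coordinates by one common element. The diagonal act supplies
  it: (m, n) is a point of that act, so (m, n) = (u, v)c with u in U, v in V and a single c. Hence a
  = (xu)c and b = (yv)c. As the diagonal generators form a full rectangle, the pairs (xu, yv) fill
  exactly XU x YV.\<close>

theorem proposition4p4:
  fixes M :: "('a, 'm) monoid_scheme"
    and A X :: "'b set" and actA :: "'b \<Rightarrow> 'a \<Rightarrow> 'b"
    and B Y :: "'c set" and actB :: "'c \<Rightarrow> 'a \<Rightarrow> 'c"
    and U V :: "'a set"
  assumes "monoid M"
    and "U \<subseteq> carrier M" and "V \<subseteq> carrier M"
    and "act_generated_by M (carrier M \<times> carrier M) (diagonal_act M) (U \<times> V)"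
    and "monoid_act M A actA" and "monoid_act M B actB"
    and "act_generated_by M A actA X" and "act_generated_by M B actB Y"
  shows "act_generated_by M (A \<times> B) (prod_act actA actB)
           (act_image actA X U \<times> act_image actB Y V)"
proof -
  interpret A: monoid_act M A actA by fact
  interpret B: monoid_act M B actB by fact
  have XA: "X \<subseteq> A" and YB: "Y \<subseteq> B"
    using assms by (auto simp: act_generated_by_def)
  \<comment> \<open>\<open>act_generated_by\<close> also demands that generators lie in the act;
    this holds because acts are closed under multipliers from M.\<close>
  have "act_image actA X U \<subseteq> A" "act_image actB Y V \<subseteq> B"
    using XA YB assms(2,3) by (auto simp: act_image_def intro!: A.act_closed B.act_closed)
  moreover have "\<exists>z \<in> act_image actA X U \<times> act_image actB Y V. \<exists>c \<in> carrier M.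
      (a, b) = prod_act actA actB z c" if "a \<in> A" "b \<in> B" for a b
  proof -
    obtain x m where x: "x \<in> X" "m \<in> carrier M" "a = actA x m"
      using assms(7) \<open>a \<in> A\<close> unfolding act_generated_by_def by blast
    obtain y n where y: "y \<in> Y" "n \<in> carrier M" "b = actB y n"
      using assms(8) \<open>b \<in> B\<close> unfolding act_generated_by_def by blast
    \<comment> \<open>The two multipliers are now read as one point of the diagonal act, which
      trades them for the common multiplier \<open>c\<close>.\<close>
    have "(m, n) \<in> carrier M \<times> carrier M"
      using x y by simp
    then obtain p c where p: "p \<in> U \<times> V" "c \<in> carrier M" "(m, n) = diagonal_act M p c"
      using assms(4) unfolding act_generated_by_def by blast
    obtain u v where "p = (u, v)"
      by fastforce
    with p have uv: "u \<in> U" "v \<in> V" "m = u \<otimes>\<^bsub>M\<^esub> c" "n = v \<otimes>\<^bsub>M\<^esub> c"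
      by (auto simp: diagonal_act_def)
    \<comment> \<open>Compatibility of the action with multiplication regroups x(uc) as (xu)c and
      y(vc) as (yv)c.\<close>
    have "a = actA (actA x u) c" "b = actB (actB y v) c"
      using A.act_mult[of x u c] B.act_mult[of y v c] x y uv p(2) XA YB assms(2,3) by auto
    then have "(a, b) = prod_act actA actB (actA x u, actB y v) c"
      by (simp add: prod_act_def)
    moreover have "(actA x u, actB y v) \<in> act_image actA X U \<times> act_image actB Y V"
      using x(1) y(1) uv(1,2) by (auto simp: act_image_def)
    ultimately show ?thesis
      using p(2) by blast
  qed
  ultimately show ?thesis
    unfolding act_generated_by_def by blast
qed

end
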